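(* Let $A\in M_n(\mathbb{R}_+)$. Then the following assertions hold. (i) If $A=\alpha I_n$, where $\alpha\in\mathbb{R}_+$, then $\Lambda_k^{\max}(A)=\{\alpha\}$ for all $1\le k\le n$. (ii) $\Lambda_k^{\max}(\alpha A)=\alpha\Lambda_k^{\max}(A)$ for all $\alpha\in\mathbb{R}_+$ and $1\le k\le n$. (iii) $\Lambda_k^{\max}(A^t)=\Lambda_k^{\max}(A)$ for all $1\le k\le n$. (iv) $\Lambda_n^{\max}(A)\neq\emptyset$ if and only if $A=\lambda I_n$ for some $\lambda\in\mathbb{R}_+$. (v) If $B\in M_m(\mathbb{R}_+)$ is a principal submatrix of $A$ and $1\le k\le m$, then $\Lambda_k^{\max}(B)\subseteq\Lambda_k^{\max}(A)$. (vi) If $C=\begin{bmatrix}A&0\\0&B\end{bmatrix}$, where $A\in M_{n_1}(\mathbb{R}_+)$ and $B\in M_{n_2}(\mathbb{R}_+)$, then \[ \Lambda_k^{\max}(A)\cup\Lambda_k^{\max}(B)\subseteq\Lambda_k^{\max}(C),\qquad 1\le k\le\min\{n_1,n_2\}. \]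
   Context: $\mathbb{R}_+=[0,\infty)$, and $M_{m\times n}(\mathbb{R}_+)$ is the set of $m\times n$ matrices with entries in $\mathbb{R}_+$; $M_n(\mathbb{R}_+)=M_{n\times n}(\mathbb{R}_+)$. The max algebra product is $(A\otimes B)_{ij}=\max_{k}a_{ik}b_{kj}$; $X^t$ is the transpose and $I_k$ the $k\times k$ identity matrix. For $1\le k\le n$, $\mathcal{X}_{n\times k}=\{X\in M_{n\times k}(\mathbb{R}_+): X^t\otimes X=I_k\}$. For $A\in M_n(\mathbb{R}_+)$ and $1\le k\le n$, the max rank-$k$ numerical range is \[ \Lambda_k^{\max}(A)=\{\lambda\in\mathbb{R}_+: X^t\otimes A\otimes X=\lambda I_k\ \text{for some } X\in\mathcal{X}_{n\times k}\}. \] For a set $S\subseteq\mathbb{R}_+$ and $\alpha\in\mathbb{R}_+$, $\alpha S=\{\alpha s:s\in S\}$.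
   Formalization: In (ii), for α=0 it is additionally assumed that Λ_k^max(A) is nonempty; otherwise the claim fails, e.g. A=[[0,1],[1,0]], n=k=2, where Λ_2^max(A)=∅ but Λ_2^max(0·A)={0}. For α>0 nothing is added. *)

theory Defs
  imports
    Complex_Main
    "Jordan_Normal_Form.Matrix"
    "Jordan_Normal_Form.DL_Submatrix"
begin

definition nonneg_mats :: "nat \<Rightarrow> nat \<Rightarrow> real mat set" where
  "nonneg_mats m n = {A \<in> carrier_mat m n. \<forall>i<m. \<forall>j<n. 0 \<le> A $$ (i, j)}"

(* Only meaningful for a positive inner dimension dim_col A = dim_row B:
   otherwise the maximum is taken over the empty set and is unspecified. *)
definition max_mult :: "real mat \<Rightarrow> real mat \<Rightarrow> real mat" (infixl "\<otimes>\<^sub>m\<^sub>a\<^sub>x" 70) where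
  "A \<otimes>\<^sub>m\<^sub>a\<^sub>x B = mat (dim_row A) (dim_col B)
     (\<lambda>(i, j). Max ((\<lambda>l. A $$ (i, l) * B $$ (l, j)) ` {..<dim_col A}))"

definition max_isometries :: "nat \<Rightarrow> nat \<Rightarrow> real mat set" where
  "max_isometries n k = {X \<in> nonneg_mats n k. transpose_mat X \<otimes>\<^sub>m\<^sub>a\<^sub>x X = 1\<^sub>m k}"

(* The size n of the square matrix A is read off as dim_row A. *)
definition max_num_range :: "nat \<Rightarrow> real mat \<Rightarrow> real set" where
  "max_num_range k A = {c. 0 \<le> c \<and>
     (\<exists>X \<in> max_isometries (dim_row A) k.
        transpose_mat X \<otimes>\<^sub>m\<^sub>a\<^sub>x A \<otimes>\<^sub>m\<^sub>a\<^sub>x X = c \<cdot>\<^sub>m 1\<^sub>m k)}"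

definition principal_submatrix :: "real mat \<Rightarrow> real mat \<Rightarrow> bool" where
  "principal_submatrix B A \<longleftrightarrow> (\<exists>I \<subseteq> {..<dim_row A}. B = submatrix A I I)"

end

theory Submission
  imports Defs
begin

text \<open>Over the nonnegative reals a max algebra product equals a given matrix iff each entry of that
  matrix bounds the corresponding products and is attained by one of them. In this form, deleting or
  adding zero rows of an isometry is harmless, which gives the inclusions for principal
  submatrices and direct sums. A square isometry has disjoint column supports, each containing
  an entry 1, so it is a permutation matrix; hence only scalar matrices have a nonempty
  rank-n range.\<close>

section \<open>Entrywise description of max products, isometries and the numerical range\<close>

lemma Max_image_eq_iff:
  fixes f :: "'a \<Rightarrow> 'b::linorder"
  assumes "finite S" "S \<noteq> {}"
  shows "Max (f ` S) = c \<longleftrightarrow> (\<forall>s\<in>S. f s \<le> c) \<and> (\<exists>s\<in>S. f s = c)"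
  using assms by (subst Max_eq_iff) auto

lemma nonneg_matsD:
  assumes "A \<in> nonneg_mats m n"
  shows "dim_row A = m" "dim_col A = n" "\<And>i j. i < m \<Longrightarrow> j < n \<Longrightarrow> 0 \<le> A $$ (i, j)"
  using assms by (auto simp: nonneg_mats_def)

lemma index_max_mult:
  assumes "i < dim_row A" "j < dim_col B"
  shows "(A \<otimes>\<^sub>m\<^sub>a\<^sub>x B) $$ (i, j) = Max ((\<lambda>l. A $$ (i, l) * B $$ (l, j)) ` {..<dim_col A})"
  using assms by (simp add: max_mult_def)

lemma dim_max_mult [simp]:
  "dim_row (A \<otimes>\<^sub>m\<^sub>a\<^sub>x B) = dim_row A" "dim_col (A \<otimes>\<^sub>m\<^sub>a\<^sub>x B) = dim_col B"
  by (simp_all add: max_mult_def)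

text \<open>As the entries of X are nonnegative, the condition for i = j makes 1 the largest entry
  of each column, and the one for i \<noteq> j makes the supports of two columns disjoint. With
  \<open>1 \<le> n\<close> the maxima are taken over nonempty sets.\<close>

lemma mem_max_isometries_iff:
  assumes "1 \<le> n"
  shows "X \<in> max_isometries n k \<longleftrightarrow> X \<in> nonneg_mats n k \<and>
    (\<forall>i<k. \<forall>j<k. (\<forall>p<n. X $$ (p, i) * X $$ (p, j) \<le> (if i = j then 1 else 0)) \<and>
                 (\<exists>p<n. X $$ (p, i) * X $$ (p, j) = (if i = j then 1 else 0)))"
proof (cases "X \<in> nonneg_mats n k")
  case True
  note X = nonneg_matsD[OF True]
  have ent: "(transpose_mat X \<otimes>\<^sub>m\<^sub>a\<^sub>x X) $$ (i, j) = c \<longleftrightarrow>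
      (\<forall>p<n. X $$ (p, i) * X $$ (p, j) \<le> c) \<and> (\<exists>p<n. X $$ (p, i) * X $$ (p, j) = c)"
    if "i < k" "j < k" for i j c
  proof -
    have "(transpose_mat X \<otimes>\<^sub>m\<^sub>a\<^sub>x X) $$ (i, j) = Max ((\<lambda>p. X $$ (p, i) * X $$ (p, j)) ` {..<n})"
      using that X by (simp add: index_max_mult cong: image_cong_simp)
    also have "\<dots> = c \<longleftrightarrow> (\<forall>p\<in>{..<n}. X $$ (p, i) * X $$ (p, j) \<le> c) \<and>
        (\<exists>p\<in>{..<n}. X $$ (p, i) * X $$ (p, j) = c)"
      using assms by (intro Max_image_eq_iff) (auto simp: lessThan_empty_iff)
    finally show ?thesis by auto
  qed
  have "transpose_mat X \<otimes>\<^sub>m\<^sub>a\<^sub>x X = 1\<^sub>m k \<longleftrightarrow>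
      (\<forall>i<k. \<forall>j<k. (transpose_mat X \<otimes>\<^sub>m\<^sub>a\<^sub>x X) $$ (i, j) = (if i = j then 1 else 0))"
    using X by (auto simp: mat_eq_iff)
  then show ?thesis
    using True by (simp add: max_isometries_def ent)
qed (simp add: max_isometries_def)

text \<open>Multiplication by the nonnegative entry X(q, j) is monotone and so commutes with the
  inner maximum over p; the nested maxima become one maximum over pairs (p, q).\<close>

lemma max_mult_triple_index_eq_iff:
  assumes n: "1 \<le> n" and A: "A \<in> nonneg_mats n n" and X: "X \<in> nonneg_mats n k"
    and ij: "i < k" "j < k"
  shows "(transpose_mat X \<otimes>\<^sub>m\<^sub>a\<^sub>x A \<otimes>\<^sub>m\<^sub>a\<^sub>x X) $$ (i, j) = c \<longleftrightarrow>
    (\<forall>p<n. \<forall>q<n. X $$ (p, i) * A $$ (p, q) * X $$ (q, j) \<le> c) \<and>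
    (\<exists>p<n. \<exists>q<n. X $$ (p, i) * A $$ (p, q) * X $$ (q, j) = c)"
proof -
  note A = nonneg_matsD[OF A] and X = nonneg_matsD[OF X]
  define M where "M q = Max ((\<lambda>p. X $$ (p, i) * A $$ (p, q)) ` {..<n})" for q
  have M: "(\<forall>p<n. X $$ (p, i) * A $$ (p, q) \<le> M q) \<and> (\<exists>p<n. X $$ (p, i) * A $$ (p, q) = M q)" for q
    using Max_image_eq_iff[of "{..<n}" "\<lambda>p. X $$ (p, i) * A $$ (p, q)" "M q"] n
    by (auto simp: M_def lessThan_empty_iff)
  have inner: "(transpose_mat X \<otimes>\<^sub>m\<^sub>a\<^sub>x A) $$ (i, q) = M q" if "q < n" for q
    using that ij A X by (simp add: index_max_mult M_def cong: image_cong_simp)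
  have "(transpose_mat X \<otimes>\<^sub>m\<^sub>a\<^sub>x A \<otimes>\<^sub>m\<^sub>a\<^sub>x X) $$ (i, j) = Max ((\<lambda>q. M q * X $$ (q, j)) ` {..<n})"
    using ij A X by (simp add: index_max_mult[of i "transpose_mat X \<otimes>\<^sub>m\<^sub>a\<^sub>x A"] inner
        cong: image_cong_simp)
  also have "\<dots> = c \<longleftrightarrow> (\<forall>q\<in>{..<n}. M q * X $$ (q, j) \<le> c) \<and> (\<exists>q\<in>{..<n}. M q * X $$ (q, j) = c)"
    using n by (intro Max_image_eq_iff) (auto simp: lessThan_empty_iff)
  also have "\<dots> \<longleftrightarrow> (\<forall>p<n. \<forall>q<n. X $$ (p, i) * A $$ (p, q) * X $$ (q, j) \<le> c) \<and>
      (\<exists>p<n. \<exists>q<n. X $$ (p, i) * A $$ (p, q) * X $$ (q, j) = c)" (is "?L \<longleftrightarrow> ?R")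
  proof
    have le: "X $$ (p, i) * A $$ (p, q) * X $$ (q, j) \<le> M q * X $$ (q, j)" if "p < n" "q < n" for p q
      using that M X ij by (intro mult_right_mono) auto
    {
      assume L: ?L
      obtain q where q: "q < n" "M q * X $$ (q, j) = c"
        using L by auto
      obtain p where "p < n" "X $$ (p, i) * A $$ (p, q) = M q"
        using M by blast
      then have "\<exists>p<n. \<exists>q<n. X $$ (p, i) * A $$ (p, q) * X $$ (q, j) = c"
        using q by metis
      moreover have "X $$ (p, i) * A $$ (p, q) * X $$ (q, j) \<le> c" if "p < n" "q < n" for p q
        using le[OF that] L that by (meson lessThan_iff order_trans)
      ultimately show ?R by blast
    next
      assume R: ?R
      \<comment> \<open>\<open>M q\<close> is itself one of the products X(p, i) A(p, q), so the
        bound on all products applies to it.\<close>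
      have ub: "M q * X $$ (q, j) \<le> c" if "q < n" for q
        using M[of q] R that by metis
      obtain p q where pq: "p < n" "q < n" "X $$ (p, i) * A $$ (p, q) * X $$ (q, j) = c"
        using R by blast
      have "M q * X $$ (q, j) = c"
        using le[OF pq(1,2)] ub[OF pq(2)] pq(3) by linarith
      then show ?L
        using ub pq(2) by auto
    }
  qed
  finally show ?thesis .
qed

text \<open>Replaces the matrix equation by conditions on single products of three entries, so that
  later an isometry can be transferred from one matrix to another product by product.\<close>

lemma mem_max_num_range_iff:
  assumes n: "1 \<le> n" and A: "A \<in> nonneg_mats n n"
  shows "c \<in> max_num_range k A \<longleftrightarrow> 0 \<le> c \<and> (\<exists>X\<in>max_isometries n k. \<forall>i<k. \<forall>j<k.
    (\<forall>p<n. \<forall>q<n. X $$ (p, i) * A $$ (p, q) * X $$ (q, j) \<le> (if i = j then c else 0)) \<and>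
    (\<exists>p<n. \<exists>q<n. X $$ (p, i) * A $$ (p, q) * X $$ (q, j) = (if i = j then c else 0)))"
proof -
  have "transpose_mat X \<otimes>\<^sub>m\<^sub>a\<^sub>x A \<otimes>\<^sub>m\<^sub>a\<^sub>x X = c \<cdot>\<^sub>m 1\<^sub>m k \<longleftrightarrow> (\<forall>i<k. \<forall>j<k.
    (\<forall>p<n. \<forall>q<n. X $$ (p, i) * A $$ (p, q) * X $$ (q, j) \<le> (if i = j then c else 0)) \<and>
    (\<exists>p<n. \<exists>q<n. X $$ (p, i) * A $$ (p, q) * X $$ (q, j) = (if i = j then c else 0)))"
    if "X \<in> max_isometries n k" for X
  proof -
    have X: "X \<in> nonneg_mats n k"
      using that by (simp add: max_isometries_def)
    have "transpose_mat X \<otimes>\<^sub>m\<^sub>a\<^sub>x A \<otimes>\<^sub>m\<^sub>a\<^sub>x X = c \<cdot>\<^sub>m 1\<^sub>m k \<longleftrightarrow> (\<forall>i<k. \<forall>j<k.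
      (transpose_mat X \<otimes>\<^sub>m\<^sub>a\<^sub>x A \<otimes>\<^sub>m\<^sub>a\<^sub>x X) $$ (i, j) = (if i = j then c else 0))"
      using nonneg_matsD[OF X] by (auto simp: mat_eq_iff)
    then show ?thesis
      by (simp add: max_mult_triple_index_eq_iff[OF n A X])
  qed
  then show ?thesis
    using nonneg_matsD(1)[OF A] by (auto simp: max_num_range_def)
qed

section \<open>Scalar matrices and scaling\<close>

text \<open>Only the terms with p = q can be nonzero, so X^t A X is a times X^t X, that is, a times
  the identity.\<close>

lemma max_num_range_smult_one:
  assumes k: "1 \<le> k" "k \<le> n" and a: "0 \<le> a"
  shows "max_num_range k (a \<cdot>\<^sub>m 1\<^sub>m n) = {a}"
proof -
  let ?A = "a \<cdot>\<^sub>m 1\<^sub>m n :: real mat"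
  have n: "1 \<le> n" using k by simp
  have A: "?A \<in> nonneg_mats n n"
    using a by (auto simp: nonneg_mats_def)
  have "c = a" if "c \<in> max_num_range k ?A" for c
  proof -
    obtain X where X: "X \<in> max_isometries n k" and *: "\<forall>i<k. \<forall>j<k.
      (\<forall>p<n. \<forall>q<n. X $$ (p, i) * ?A $$ (p, q) * X $$ (q, j) \<le> (if i = j then c else 0)) \<and>
      (\<exists>p<n. \<exists>q<n. X $$ (p, i) * ?A $$ (p, q) * X $$ (q, j) = (if i = j then c else 0))"
      using \<open>c \<in> max_num_range k ?A\<close> unfolding mem_max_num_range_iff[OF n A] by blast
    \<comment> \<open>One diagonal entry already determines c; column 0 exists because
      \<open>1 \<le> k\<close>.\<close>
    have k0: "0 < k" using k by simp
    have ub: "\<forall>p<n. \<forall>q<n. X $$ (p, 0) * ?A $$ (p, q) * X $$ (q, 0) \<le> c"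
      and ex: "\<exists>p<n. \<exists>q<n. X $$ (p, 0) * ?A $$ (p, q) * X $$ (q, 0) = c"
      using *[rule_format, OF k0 k0] by simp_all
    have le1: "\<forall>p<n. X $$ (p, 0) * X $$ (p, 0) \<le> 1"
      and ex1: "\<exists>p<n. X $$ (p, 0) * X $$ (p, 0) = 1"
      using mem_max_isometries_iff[OF n, THEN iffD1, OF X, THEN conjunct2, rule_format, OF k0 k0]
      by simp_all
    obtain p where p: "p < n" "X $$ (p, 0) * X $$ (p, 0) = 1"
      using ex1 by blast
    have "a * (X $$ (p, 0) * X $$ (p, 0)) \<le> c"
      using ub[rule_format, OF p(1) p(1)] p(1) by (simp add: mult_ac)
    then have "a \<le> c"
      using p(2) by simp
    obtain p q where pq: "p < n" "q < n" "X $$ (p, 0) * ?A $$ (p, q) * X $$ (q, 0) = c"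
      using ex by blast
    \<comment> \<open>For p = q the square of an entry of X is at most 1; for p \<noteq> q the entry
      of the scalar matrix is 0, which forces c = 0 \<le> a.\<close>
    have "c \<le> a"
    proof (cases "p = q")
      case True
      then have "c = a * (X $$ (p, 0) * X $$ (p, 0))"
        using pq by (auto simp: mult_ac)
      also have "\<dots> \<le> a * 1"
        using le1 pq a by (intro mult_left_mono) auto
      finally show ?thesis by simp
    qed (use pq a in auto)
    with \<open>a \<le> c\<close> show ?thesis by simp
  qed
  moreover have "a \<in> max_num_range k ?A"
  proof -
    \<comment> \<open>The witness consists of the first k columns of the identity, available since
      \<open>k \<le> n\<close>.\<close>
    define X :: "real mat" where "X = mat n k (\<lambda>(i, j). if i = j then 1 else 0)"
    have ent: "X $$ (p, i) = (if p = i then 1 else 0)" if "p < n" "i < k" for p i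
      using that by (simp add: X_def)
    have "X \<in> max_isometries n k"
      unfolding mem_max_isometries_iff[OF n]
    proof (intro conjI allI impI)
      show "X \<in> nonneg_mats n k"
        by (auto simp: nonneg_mats_def X_def)
    next
      fix i j assume ij: "i < k" "j < k"
      show "\<exists>p<n. X $$ (p, i) * X $$ (p, j) = (if i = j then 1 else 0)"
        using ij k by (intro exI[of _ i]) (auto simp: ent)
    qed (auto simp: ent)
    \<comment> \<open>At p = i and q = j both factors from X are 1, which leaves the entry (i, j) of
      the scalar matrix.\<close>
    moreover have "\<exists>p<n. \<exists>q<n. X $$ (p, i) * ?A $$ (p, q) * X $$ (q, j) = (if i = j then a else 0)"
      if "i < k" "j < k" for i j
      using that k by (intro exI[of _ i] conjI) (auto simp: ent intro!: exI[of _ j])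
    moreover have "X $$ (p, i) * ?A $$ (p, q) * X $$ (q, j) \<le> (if i = j then a else 0)"
      if "i < k" "j < k" "p < n" "q < n" for i j p q
      using that a by (auto simp: ent)
    ultimately show ?thesis
      unfolding mem_max_num_range_iff[OF n A] using a by blast
  qed
  ultimately show ?thesis by blast
qed

text \<open>The same isometry serves both matrices: every product acquires the factor a, which
  preserves the bounds and the attained values.\<close>

lemma max_num_range_smult_imp:
  assumes n: "1 \<le> n" and A: "A \<in> nonneg_mats n n" and a: "0 < a"
    and c: "c \<in> max_num_range k A"
  shows "a * c \<in> max_num_range k (a \<cdot>\<^sub>m A)"
proof -
  have aA: "a \<cdot>\<^sub>m A \<in> nonneg_mats n n"
    using A a by (auto simp: nonneg_mats_def)
  have ent: "X $$ (p, i) * (a \<cdot>\<^sub>m A) $$ (p, q) * X $$ (q, j)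
      = a * (X $$ (p, i) * A $$ (p, q) * X $$ (q, j))" if "p < n" "q < n" for X p q i j
    using that nonneg_matsD[OF A] by simp
  obtain X where c0: "0 \<le> c" and X: "X \<in> max_isometries n k"
    and *: "\<forall>i<k. \<forall>j<k.
    (\<forall>p<n. \<forall>q<n. X $$ (p, i) * A $$ (p, q) * X $$ (q, j) \<le> (if i = j then c else 0)) \<and>
    (\<exists>p<n. \<exists>q<n. X $$ (p, i) * A $$ (p, q) * X $$ (q, j) = (if i = j then c else 0))"
    using c unfolding mem_max_num_range_iff[OF n A] by blast
  have if_eq: "(if i = j then a * c else 0) = a * (if i = j then c else 0)" for i j :: nat
    by simp
  show ?thesis
    unfolding mem_max_num_range_iff[OF n aA] if_eq
  proof (intro conjI bexI[OF _ X] allI impI)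
    show "0 \<le> a * c" using a c0 by simp
  next
    fix i j p q assume h: "i < k" "j < k" "p < n" "q < n"
    then have "X $$ (p, i) * A $$ (p, q) * X $$ (q, j) \<le> (if i = j then c else 0)"
      using * by blast
    then show "X $$ (p, i) * (a \<cdot>\<^sub>m A) $$ (p, q) * X $$ (q, j) \<le> a * (if i = j then c else 0)"
      unfolding ent[OF h(3,4)] using a by (intro mult_left_mono) auto
  next
    fix i j assume h: "i < k" "j < k"
    then obtain p q where pq: "p < n" "q < n"
      "X $$ (p, i) * A $$ (p, q) * X $$ (q, j) = (if i = j then c else 0)"
      using * by blast
    have "X $$ (p, i) * (a \<cdot>\<^sub>m A) $$ (p, q) * X $$ (q, j) = a * (if i = j then c else 0)"
      unfolding ent[OF pq(1,2)] pq(3) ..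
    then show "\<exists>p<n. \<exists>q<n. X $$ (p, i) * (a \<cdot>\<^sub>m A) $$ (p, q) * X $$ (q, j) = a * (if i = j then c else 0)"
      using pq(1,2) by blast
  qed
qed

lemma max_num_range_smult:
  assumes n: "1 \<le> n" and A: "A \<in> nonneg_mats n n" and a: "0 < a"
  shows "max_num_range k (a \<cdot>\<^sub>m A) = (\<lambda>s. a * s) ` max_num_range k A"
proof (intro equalityI subsetI)
  fix c assume c: "c \<in> max_num_range k (a \<cdot>\<^sub>m A)"
  have "a \<cdot>\<^sub>m A \<in> nonneg_mats n n"
    using A a by (auto simp: nonneg_mats_def)
  \<comment> \<open>The reverse inclusion is the forward one for the matrix
    \<open>a \<cdot>\<^sub>m A\<close> and the factor 1/a; here a must be nonzero.\<close>
  moreover have "(1 / a) \<cdot>\<^sub>m (a \<cdot>\<^sub>m A) = A"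
    using a by (intro eq_matI) auto
  ultimately have "(1 / a) * c \<in> max_num_range k A"
    using max_num_range_smult_imp[of n "a \<cdot>\<^sub>m A" "1 / a" c k] n a c by simp
  then show "c \<in> (\<lambda>s. a * s) ` max_num_range k A"
    using a by (intro image_eqI[of _ _ "(1 / a) * c"]) auto
qed (use max_num_range_smult_imp[OF assms] in auto)

section \<open>Transposition\<close>

text \<open>The same X works: entry (i, j) of X^t A^t X is entry (j, i) of X^t A X, and a multiple
  of the identity is symmetric. Applied to A^t as well, the inclusion becomes an equality.\<close>

lemma max_num_range_transpose_subset:
  assumes n: "1 \<le> n" and A: "A \<in> nonneg_mats n n"
  shows "max_num_range k A \<subseteq> max_num_range k (transpose_mat A)"
proof
  fix c assume "c \<in> max_num_range k A"
  then obtain X where c0: "0 \<le> c" and X: "X \<in> max_isometries n k"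
    and *: "\<forall>i<k. \<forall>j<k.
    (\<forall>p<n. \<forall>q<n. X $$ (p, i) * A $$ (p, q) * X $$ (q, j) \<le> (if i = j then c else 0)) \<and>
    (\<exists>p<n. \<exists>q<n. X $$ (p, i) * A $$ (p, q) * X $$ (q, j) = (if i = j then c else 0))"
    unfolding mem_max_num_range_iff[OF n A] by blast
  have At: "transpose_mat A \<in> nonneg_mats n n"
    using A by (auto simp: nonneg_mats_def)
  have ent: "X $$ (p, i) * transpose_mat A $$ (p, q) * X $$ (q, j)
      = X $$ (q, j) * A $$ (q, p) * X $$ (p, i)" if "p < n" "q < n" for p q i j
    using that nonneg_matsD[OF A] by simp
  have if_eq: "(if i = j then c else 0) = (if j = i then c else 0)" for i j :: nat
    by simp
  show "c \<in> max_num_range k (transpose_mat A)"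
    unfolding mem_max_num_range_iff[OF n At]
  proof (intro conjI bexI[OF _ X] allI impI)
    fix i j p q assume h: "i < k" "j < k" "p < n" "q < n"
    show "X $$ (p, i) * transpose_mat A $$ (p, q) * X $$ (q, j) \<le> (if i = j then c else 0)"
      unfolding ent[OF h(3,4)] if_eq[of i] using * h by blast
  next
    fix i j assume h: "i < k" "j < k"
    then obtain p q where "p < n" "q < n"
      "X $$ (p, j) * A $$ (p, q) * X $$ (q, i) = (if j = i then c else 0)"
      using * by blast
    then show "\<exists>p<n. \<exists>q<n. X $$ (p, i) * transpose_mat A $$ (p, q) * X $$ (q, j) = (if i = j then c else 0)"
      using ent if_eq by metis
  qed (fact c0)
qed

lemma max_num_range_transpose:
  assumes "1 \<le> n" "A \<in> nonneg_mats n n"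
  shows "max_num_range k (transpose_mat A) = max_num_range k A"
proof -
  have "transpose_mat A \<in> nonneg_mats n n"
    using assms(2) by (auto simp: nonneg_mats_def)
  then show ?thesis
    using max_num_range_transpose_subset[of n A k] max_num_range_transpose_subset[of n "transpose_mat A" k]
      assms by auto
qed

section \<open>Rank n forces a scalar matrix\<close>

text \<open>Once X is known to be the permutation matrix of some \<sigma>, X^t A X only relabels
  indices: its entry (i, j) is A(\<sigma> i, \<sigma> j), to be compared with c times the
  identity.\<close>

lemma scalar_if_full_rank_max_num_range:
  assumes n: "1 \<le> n" and A: "A \<in> nonneg_mats n n" and c: "c \<in> max_num_range n A"
  shows "A = c \<cdot>\<^sub>m 1\<^sub>m n"
proof -
  obtain X where c0: "0 \<le> c" and X: "X \<in> max_isometries n n"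
    and *: "\<forall>i<n. \<forall>j<n.
    (\<forall>p<n. \<forall>q<n. X $$ (p, i) * A $$ (p, q) * X $$ (q, j) \<le> (if i = j then c else 0)) \<and>
    (\<exists>p<n. \<exists>q<n. X $$ (p, i) * A $$ (p, q) * X $$ (q, j) = (if i = j then c else 0))"
    using c unfolding mem_max_num_range_iff[OF n A] by blast
  have ub: "X $$ (p, i) * A $$ (p, q) * X $$ (q, j) \<le> (if i = j then c else 0)"
    if "i < n" "j < n" "p < n" "q < n" for i j p q
    using * that by blast
  have ex: "\<exists>p<n. \<exists>q<n. X $$ (p, i) * A $$ (p, q) * X $$ (q, i) = c" if "i < n" for i
    using *[rule_format, OF that that] by simp
  note A' = nonneg_matsD[OF A]
  have Xn: "X \<in> nonneg_mats n n"
    and iso: "\<forall>i<n. \<forall>j<n.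
      (\<forall>p<n. X $$ (p, i) * X $$ (p, j) \<le> (if i = j then 1 else 0)) \<and>
      (\<exists>p<n. X $$ (p, i) * X $$ (p, j) = (if i = j then 1 else 0))"
    using X unfolding mem_max_isometries_iff[OF n] by blast+
  have orth: "X $$ (p, i) * X $$ (p, j) \<le> 0" if "i < n" "j < n" "i \<noteq> j" "p < n" for i j p
    using iso[rule_format, OF that(1,2)] that(3,4) by simp
  have unit: "\<exists>p<n. X $$ (p, i) * X $$ (p, i) = 1" if "i < n" for i
    using iso[rule_format, OF that that] by simp
  note X' = nonneg_matsD[OF Xn]
  have "\<exists>p<n. X $$ (p, i) = 1" if i: "i < n" for i
  proof -
    obtain p where p: "p < n" "X $$ (p, i) * X $$ (p, i) = 1"
      using unit[OF i] by blast
    then have "X $$ (p, i) = 1"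
      using X'(3)[OF p(1) i] square_eq_1_iff[of "X $$ (p, i)"] by auto
    with p show ?thesis by blast
  qed
  then obtain \<sigma> where \<sigma>: "\<And>i. i < n \<Longrightarrow> \<sigma> i < n" "\<And>i. i < n \<Longrightarrow> X $$ (\<sigma> i, i) = 1"
    by metis
  \<comment> \<open>Column i has the entry 1 in row \<sigma> i, so disjointness of supports clears
    the rest of that row.\<close>
  have off: "X $$ (\<sigma> i, j) = 0" if "i < n" "j < n" "i \<noteq> j" for i j
    using orth[OF that \<sigma>(1)] X'(3)[of "\<sigma> i" j] \<sigma> that by force
  have "inj_on \<sigma> {..<n}"
  proof (rule inj_onI)
    fix i j assume h: "i \<in> {..<n}" "j \<in> {..<n}" "\<sigma> i = \<sigma> j"
    show "i = j"
    proof (rule ccontr)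
      assume "i \<noteq> j"
      then show False
        using off[of i j] \<sigma>(2)[of j] h by simp
    qed
  qed
  \<comment> \<open>Squareness enters here: an injection of a finite set into itself is onto, so
    every row is a row \<sigma> i' with a single nonzero entry, in column i'.\<close>
  then have surj: "\<sigma> ` {..<n} = {..<n}"
    using \<sigma>(1) by (intro endo_inj_surj) auto
  have supp: "p = \<sigma> i" if "p < n" "i < n" "X $$ (p, i) \<noteq> 0" for p i
  proof -
    obtain i' where "i' < n" "p = \<sigma> i'"
      using surj \<open>p < n\<close> by (metis imageE lessThan_iff)
    then show ?thesis
      using off[of i' i] that by auto
  qed
  \<comment> \<open>At rows \<sigma> i and \<sigma> j the factors from X are 1, so the upper bound 0
    falls on the entry of A itself.\<close>
  have offdiag: "A $$ (\<sigma> i, \<sigma> j) = 0" if "i < n" "j < n" "i \<noteq> j" for i j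
    using ub[of i j "\<sigma> i" "\<sigma> j"] A'(3)[of "\<sigma> i" "\<sigma> j"] \<sigma> that by auto
  have diag: "A $$ (\<sigma> i, \<sigma> i) = c" if i: "i < n" for i
  \<comment> \<open>For c = 0 the value may be attained through a zero entry of X, so the upper
    bound and nonnegativity decide. For c \<noteq> 0 the attaining product has nonzero factors from
    X, which forces p = q = \<sigma> i.\<close>
  proof (cases "c = 0")
    case True
    then show ?thesis
      using ub[of i i "\<sigma> i" "\<sigma> i"] A'(3)[of "\<sigma> i" "\<sigma> i"] \<sigma> i by auto
  next
    case False
    obtain p q where "p < n" "q < n" "X $$ (p, i) * A $$ (p, q) * X $$ (q, i) = c"
      using ex[OF i] by blast
    then show ?thesis
      using False supp[of p i] supp[of q i] \<sigma>(2)[OF i] i by auto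
  qed
  show ?thesis
  proof (rule eq_matI)
    fix p q assume "p < dim_row (c \<cdot>\<^sub>m 1\<^sub>m n)" "q < dim_col (c \<cdot>\<^sub>m 1\<^sub>m n)"
    then have pq: "p < n" "q < n" by auto
    then obtain i j where "i < n" "p = \<sigma> i" "j < n" "q = \<sigma> j"
      using surj by (metis imageE lessThan_iff)
    then show "A $$ (p, q) = (c \<cdot>\<^sub>m 1\<^sub>m n) $$ (p, q)"
      using diag[of i] offdiag[of i j] pq \<open>inj_on \<sigma> {..<n}\<close>
      by (cases "i = j") (auto simp: inj_on_def)
  qed (use A' in auto)
qed

section \<open>Embedding of index sets: principal submatrices and direct sums\<close>

text \<open>An isometry for the smaller matrix becomes one for the larger matrix by inserting zero rows
  outside the range of \<open>f\<close>.\<close>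

lemma max_num_range_embed:
  assumes m: "1 \<le> m" and A: "A \<in> nonneg_mats n n" and B: "B \<in> nonneg_mats m m"
    and inj: "inj_on f {..<m}" and f: "\<And>i. i < m \<Longrightarrow> f i < n"
    and AB: "\<And>i j. \<lbrakk>i < m; j < m\<rbrakk> \<Longrightarrow> B $$ (i, j) = A $$ (f i, f j)"
  shows "max_num_range k B \<subseteq> max_num_range k A"
proof
  fix c assume "c \<in> max_num_range k B"
  then obtain X where c0: "0 \<le> c" and X: "X \<in> max_isometries m k"
    and *: "\<forall>i<k. \<forall>j<k.
    (\<forall>p<m. \<forall>q<m. X $$ (p, i) * B $$ (p, q) * X $$ (q, j) \<le> (if i = j then c else 0)) \<and>
    (\<exists>p<m. \<exists>q<m. X $$ (p, i) * B $$ (p, q) * X $$ (q, j) = (if i = j then c else 0))"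
    unfolding mem_max_num_range_iff[OF m B] by blast
  have Xn: "X \<in> nonneg_mats m k"
    and iso: "\<forall>i<k. \<forall>j<k. (\<forall>p<m. X $$ (p, i) * X $$ (p, j) \<le> (if i = j then 1 else 0)) \<and>
                 (\<exists>p<m. X $$ (p, i) * X $$ (p, j) = (if i = j then 1 else 0))"
    using X unfolding mem_max_isometries_iff[OF m] by blast+
  note X' = nonneg_matsD[OF Xn]
  have n: "1 \<le> n"
    using f[of 0] m by simp
  \<comment> \<open>Row f p of Y is row p of X; \<open>the_inv_into\<close> recovers p, which is
    unique because f is injective.\<close>
  define Y where "Y = mat n k (\<lambda>(p, i).
    if p \<in> f ` {..<m} then X $$ (the_inv_into {..<m} f p, i) else 0)"
  have Yf: "Y $$ (f p, i) = X $$ (p, i)" if "p < m" "i < k" for p i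
    using that f inj by (simp add: Y_def the_inv_into_f_f)
  have Y0: "Y $$ (p, i) = 0" if "p < n" "i < k" "p \<notin> f ` {..<m}" for p i
    using that by (simp add: Y_def)
  have Y: "Y \<in> max_isometries n k"
    unfolding mem_max_isometries_iff[OF n]
  proof (intro conjI allI impI)
    have "0 \<le> Y $$ (p, i)" if "p < n" "i < k" for p i
      using that X'(3) Yf Y0[OF that] by (cases "p \<in> f ` {..<m}") auto
    then show "Y \<in> nonneg_mats n k"
      by (auto simp: nonneg_mats_def Y_def)
  next
    fix i j p assume h: "i < k" "j < k" "p < n"
    show "Y $$ (p, i) * Y $$ (p, j) \<le> (if i = j then 1 else 0)"
    proof (cases "p \<in> f ` {..<m}")
      case True
      then obtain p' where "p' < m" "p = f p'" by auto
      then show ?thesis using iso h Yf by metis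
    qed (use h Y0 in auto)
  next
    fix i j assume h: "i < k" "j < k"
    then obtain p where "p < m" "X $$ (p, i) * X $$ (p, j) = (if i = j then 1 else 0)"
      using iso by blast
    then show "\<exists>p<n. Y $$ (p, i) * Y $$ (p, j) = (if i = j then 1 else 0)"
      using h Yf f by metis
  qed
  show "c \<in> max_num_range k A"
    unfolding mem_max_num_range_iff[OF n A]
  proof (intro conjI bexI[OF _ Y] allI impI)
    fix i j p q assume h: "i < k" "j < k" "p < n" "q < n"
    show "Y $$ (p, i) * A $$ (p, q) * Y $$ (q, j) \<le> (if i = j then c else 0)"
    proof (cases "p \<in> f ` {..<m} \<and> q \<in> f ` {..<m}")
      case True
      then obtain p' q' where "p' < m" "p = f p'" "q' < m" "q = f q'" by auto
      then show ?thesis using * h Yf AB by metis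
    next
      case False
      \<comment> \<open>A row outside the range of f contributes a factor 0, and the product 0
        respects the bound because c \<ge> 0.\<close>
      then have "Y $$ (p, i) = 0 \<or> Y $$ (q, j) = 0"
        using h Y0 by blast
      then show ?thesis using c0 by auto
    qed
  next
    fix i j assume h: "i < k" "j < k"
    then obtain p q where pq: "p < m" "q < m"
      "X $$ (p, i) * B $$ (p, q) * X $$ (q, j) = (if i = j then c else 0)"
      using * by blast
    then show "\<exists>p<n. \<exists>q<n. Y $$ (p, i) * A $$ (p, q) * Y $$ (q, j) = (if i = j then c else 0)"
      using h Yf f AB by (intro exI[of _ "f p"] exI[of _ "f q"] conjI) auto
  qed (fact c0)
qed

text \<open>The embedding is \<open>pick I\<close>, the increasing enumeration of the index set,
  through which \<open>submatrix\<close> reads off its entries.\<close>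

lemma max_num_range_principal_submatrix:
  assumes "1 \<le> m" and A: "A \<in> nonneg_mats n n" and B: "B \<in> nonneg_mats m m"
    and "principal_submatrix B A"
  shows "max_num_range k B \<subseteq> max_num_range k A"
proof -
  obtain I where I: "I \<subseteq> {..<n}" "B = submatrix A I I"
    using assms(4) nonneg_matsD[OF A] by (auto simp: principal_submatrix_def)
  \<comment> \<open>The size of a submatrix is the cardinality of the set of indices below n lying
    in I; here that set is all of I.\<close>
  have eq: "{i. i < n \<and> i \<in> I} = I"
    using I(1) by auto
  \<comment> \<open>Below the cardinality of I, \<open>pick I\<close> is strictly increasing with
    values in I.\<close>
  have m: "m = card I"
    using nonneg_matsD(1)[OF B] nonneg_matsD(1)[OF A] I(2) eq by (simp add: dim_submatrix)
  show ?thesis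
  proof (rule max_num_range_embed[where f = "pick I", OF assms(1) A B])
    show "inj_on (pick I) {..<m}"
      using m by (intro linorder_inj_onI) (auto dest: pick_mono_le[of _ I])
    show "pick I i < n" if "i < m" for i
      using pick_in_set_le[of i I] that m I(1) by auto
    show "B $$ (i, j) = A $$ (pick I i, pick I j)" if "i < m" "j < m" for i j
      using that m eq nonneg_matsD[OF A] I(2) by (simp add: submatrix_index)
  qed
qed

text \<open>Each block sits in the direct sum on consecutive indices: A starts at index 0, and B is
  shifted by the size of A.\<close>

lemma max_num_range_block_diag:
  assumes "1 \<le> n\<^sub>1" "1 \<le> n\<^sub>2" and A: "A \<in> nonneg_mats n\<^sub>1 n\<^sub>1" and B: "B \<in> nonneg_mats n\<^sub>2 n\<^sub>2"
  shows "max_num_range k A \<union> max_num_range k B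
    \<subseteq> max_num_range k (four_block_mat A (0\<^sub>m n\<^sub>1 n\<^sub>2) (0\<^sub>m n\<^sub>2 n\<^sub>1) B)"
proof -
  let ?C = "four_block_mat A (0\<^sub>m n\<^sub>1 n\<^sub>2) (0\<^sub>m n\<^sub>2 n\<^sub>1) B"
  note A' = nonneg_matsD[OF A] and B' = nonneg_matsD[OF B]
  have C: "?C \<in> nonneg_mats (n\<^sub>1 + n\<^sub>2) (n\<^sub>1 + n\<^sub>2)"
    using A' B' by (auto simp: nonneg_mats_def)
  have "max_num_range k A \<subseteq> max_num_range k ?C"
    using A' B' by (intro max_num_range_embed[where f = id, OF assms(1) C A]) auto
  moreover have "max_num_range k B \<subseteq> max_num_range k ?C"
    using A' B' by (intro max_num_range_embed[where f = "(+) n\<^sub>1", OF assms(2) C B]) auto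
  ultimately show ?thesis by blast
qed

text \<open>For \<alpha> = 0 the scaled matrix is zero and has range {0}, whereas 0 times an empty
  range is empty. Hence the scaling clause asks for a nonempty range in that case; by the rank n
  clause, empty ranges do occur.\<close>

theorem proposition2p5:
  fixes n :: nat and A :: "real mat"
  assumes "1 \<le> n" and "A \<in> nonneg_mats n n"
  shows
    "(\<forall>\<alpha>\<ge>0. A = \<alpha> \<cdot>\<^sub>m 1\<^sub>m n \<longrightarrow> (\<forall>k. 1 \<le> k \<and> k \<le> n \<longrightarrow> max_num_range k A = {\<alpha>}))
   \<and> (\<forall>\<alpha>\<ge>0. \<forall>k. 1 \<le> k \<and> k \<le> n \<longrightarrow> (\<alpha> = 0 \<longrightarrow> max_num_range k A \<noteq> {}) \<longrightarrow>
        max_num_range k (\<alpha> \<cdot>\<^sub>m A) = (\<lambda>s. \<alpha> * s) ` max_num_range k A)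
   \<and> (\<forall>k. 1 \<le> k \<and> k \<le> n \<longrightarrow> max_num_range k (transpose_mat A) = max_num_range k A)
   \<and> (max_num_range n A \<noteq> {} \<longleftrightarrow> (\<exists>c\<ge>0. A = c \<cdot>\<^sub>m 1\<^sub>m n))
   \<and> (\<forall>m k B. B \<in> nonneg_mats m m \<and> principal_submatrix B A \<and> 1 \<le> k \<and> k \<le> m \<longrightarrow>
        max_num_range k B \<subseteq> max_num_range k A)
   \<and> (\<forall>n\<^sub>1 n\<^sub>2 A\<^sub>1 A\<^sub>2 k. A\<^sub>1 \<in> nonneg_mats n\<^sub>1 n\<^sub>1 \<and> A\<^sub>2 \<in> nonneg_mats n\<^sub>2 n\<^sub>2 \<and> 1 \<le> k \<and> k \<le> min n\<^sub>1 n\<^sub>2 \<longrightarrow>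
        max_num_range k A\<^sub>1 \<union> max_num_range k A\<^sub>2
          \<subseteq> max_num_range k (four_block_mat A\<^sub>1 (0\<^sub>m n\<^sub>1 n\<^sub>2) (0\<^sub>m n\<^sub>2 n\<^sub>1) A\<^sub>2))"
proof (intro conjI)
  show "\<forall>\<alpha>\<ge>0. A = \<alpha> \<cdot>\<^sub>m 1\<^sub>m n \<longrightarrow> (\<forall>k. 1 \<le> k \<and> k \<le> n \<longrightarrow> max_num_range k A = {\<alpha>})"
    using max_num_range_smult_one by blast
  show "\<forall>\<alpha>\<ge>0. \<forall>k. 1 \<le> k \<and> k \<le> n \<longrightarrow> (\<alpha> = 0 \<longrightarrow> max_num_range k A \<noteq> {}) \<longrightarrow>
        max_num_range k (\<alpha> \<cdot>\<^sub>m A) = (\<lambda>s. \<alpha> * s) ` max_num_range k A"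
  proof (intro allI impI)
    fix \<alpha> :: real and k
    assume h: "0 \<le> \<alpha>" "1 \<le> k \<and> k \<le> n" "\<alpha> = 0 \<longrightarrow> max_num_range k A \<noteq> {}"
    show "max_num_range k (\<alpha> \<cdot>\<^sub>m A) = (\<lambda>s. \<alpha> * s) ` max_num_range k A"
    proof (cases "\<alpha> = 0")
      case True
      \<comment> \<open>The zero matrix is also the scalar matrix with factor 0, so its range is
        {0}; a nonempty range multiplied by 0 is {0} too.\<close>
      have "0 \<cdot>\<^sub>m A = 0 \<cdot>\<^sub>m 1\<^sub>m n"
        using nonneg_matsD[OF assms(2)] by (intro eq_matI) auto
      then have "max_num_range k (\<alpha> \<cdot>\<^sub>m A) = {0}"
        using True h max_num_range_smult_one[of k n 0] by simp
      then show ?thesis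
        using True h by auto
    next
      case False
      then show ?thesis
        using h assms by (intro max_num_range_smult) auto
    qed
  qed
  show "\<forall>k. 1 \<le> k \<and> k \<le> n \<longrightarrow> max_num_range k (transpose_mat A) = max_num_range k A"
    using max_num_range_transpose[OF assms] by blast
  show "max_num_range n A \<noteq> {} \<longleftrightarrow> (\<exists>c\<ge>0. A = c \<cdot>\<^sub>m 1\<^sub>m n)"
  proof
    assume "max_num_range n A \<noteq> {}"
    then obtain c where c: "c \<in> max_num_range n A" by blast
    then have "0 \<le> c" by (simp add: max_num_range_def)
    with scalar_if_full_rank_max_num_range[OF assms c] show "\<exists>c\<ge>0. A = c \<cdot>\<^sub>m 1\<^sub>m n" by blast
  next
    assume "\<exists>c\<ge>0. A = c \<cdot>\<^sub>m 1\<^sub>m n"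
    then show "max_num_range n A \<noteq> {}"
      using max_num_range_smult_one[of n n] assms(1) by auto
  qed
  show "\<forall>m k B. B \<in> nonneg_mats m m \<and> principal_submatrix B A \<and> 1 \<le> k \<and> k \<le> m \<longrightarrow>
        max_num_range k B \<subseteq> max_num_range k A"
    \<comment> \<open>Transitivity through k supplies the positive size of B that the embedding
      requires.\<close>
    using max_num_range_principal_submatrix[OF _ assms(2)] le_trans by blast
  show "\<forall>n\<^sub>1 n\<^sub>2 A\<^sub>1 A\<^sub>2 k. A\<^sub>1 \<in> nonneg_mats n\<^sub>1 n\<^sub>1 \<and> A\<^sub>2 \<in> nonneg_mats n\<^sub>2 n\<^sub>2 \<and> 1 \<le> k \<and> k \<le> min n\<^sub>1 n\<^sub>2 \<longrightarrow>
        max_num_range k A\<^sub>1 \<union> max_num_range k A\<^sub>2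
          \<subseteq> max_num_range k (four_block_mat A\<^sub>1 (0\<^sub>m n\<^sub>1 n\<^sub>2) (0\<^sub>m n\<^sub>2 n\<^sub>1) A\<^sub>2)"
    by (intro allI impI max_num_range_block_diag) auto
qed

end
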